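(* Let $a$ and $c$ be real numbers with $a \geq 1$ and $c > 0$. Let $R_{\mathbb{R}}(1,c,a)$ denote the continuous 2-color Rado number for the equation $x_1 + c = a x_0$. Then $$R_{\mathbb{R}}(1,c,a) = \begin{cases} \infty & \text{if } a = 1,\\ \frac{c}{a-1} & \text{otherwise.}\end{cases}$$
   Context: The continuous 2-color Rado number $R_{\mathbb{R}}(1,c,a)$ is the smallest real number $R$ such that for every coloring of the real numbers in $[1,R]$ with two colors there exist $x_1,x_0 \in [1,R]$ (not necessarily distinct) of the same color with $x_1 + c = a x_0$ (a monochromatic solution). If no such $R$ exists, then $R_{\mathbb{R}}(1,c,a)=\infty$.
   Formalization: The formal theorem additionally assumes c ≥ a − 1 (so that c/(a−1) ≥ 1 when a > 1); for a > 1 and 0 < c < a − 1, e.g. a = 3, c = 1, the Rado number is actually ∞ and the stated formula fails. *)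

theory Defs
  imports Complex_Main "HOL-Library.Extended_Real"
begin

definition rado_forcing :: "real \<Rightarrow> real \<Rightarrow> real \<Rightarrow> bool" where
  "rado_forcing c a R \<longleftrightarrow>
     (\<forall>\<chi> :: real \<Rightarrow> bool. \<exists>x1\<in>{1..R}. \<exists>x0\<in>{1..R}. \<chi> x1 = \<chi> x0 \<and> x1 + c = a * x0)"

(* The guard requires a least forcing R, not merely an infimum of forcing values. *)
definition continuous_rado :: "real \<Rightarrow> real \<Rightarrow> ereal" where
  "continuous_rado c a =
     (if \<exists>R. rado_forcing c a R \<and> (\<forall>S. rado_forcing c a S \<longrightarrow> R \<le> S)
      then ereal (LEAST R. rado_forcing c a R)
      else \<infinity>)"

end

theory Submission
  imports Defs
begin

text \<open>
  In a solution, \<open>x\<^sub>1\<close> is the image of \<open>x\<^sub>0\<close> under the affine map \<open>x \<mapsto> a x - c\<close>.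
  If \<open>a > 1\<close>, this map has the fixed point \<open>p = c / (a - 1)\<close>, which is a monochromatic
  solution by itself, and it multiplies the distance to \<open>p\<close> by \<open>a\<close>.  Hence below \<open>p\<close> it
  increases \<open>log a (p - x)\<close> by one, and colouring by the parity of the integer part of this
  logarithm avoids all solutions.  If \<open>a = 1\<close>, the map is a translation by \<open>- c\<close> and
  \<open>- x / c\<close> plays the role of the logarithm.
\<close>

lemma not_rado_forcing_if_shift:
  fixes h :: "real \<Rightarrow> real"
  assumes "\<And>x1 x0. x1 \<in> {1..R} \<Longrightarrow> x0 \<in> {1..R} \<Longrightarrow> x1 + c = a * x0 \<Longrightarrow> h x1 = h x0 + 1"
  shows "\<not> rado_forcing c a R"
proof
  assume "rado_forcing c a R"
  then obtain x1 x0 where x: "x1 \<in> {1..R}" "x0 \<in> {1..R}" "x1 + c = a * x0"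
    and parity: "even \<lfloor>h x1\<rfloor> = even \<lfloor>h x0\<rfloor>"
    unfolding rado_forcing_def by (elim allE[of _ "\<lambda>x. even \<lfloor>h x\<rfloor>"]) blast
  from assms[OF x] have "\<lfloor>h x1\<rfloor> = \<lfloor>h x0\<rfloor> + 1"
    by simp
  with parity show False
    by simp
qed

lemma not_rado_forcing_one:
  assumes "c > 0"
  shows "\<not> rado_forcing c 1 R"
proof (rule not_rado_forcing_if_shift[where h = "\<lambda>x. - x / c"])
  fix x1 x0 :: real
  assume "x1 + c = 1 * x0"
  with assms show "- x1 / c = - x0 / c + 1"
    by (simp add: field_simps)
qed

lemma not_rado_forcing_below:
  assumes "a > 1" and "R < c / (a - 1)"
  shows "\<not> rado_forcing c a R"
proof (rule not_rado_forcing_if_shift[where h = "\<lambda>x. log a (c / (a - 1) - x)"])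
  fix x1 x0 :: real
  assume "x0 \<in> {1..R}" and eq: "x1 + c = a * x0"
  with assms have pos: "c / (a - 1) - x0 > 0"
    by simp
  have "c / (a - 1) - (a * x0 - c) = a * (c / (a - 1) - x0)"
    using assms by (simp add: field_simps)
  moreover from eq have "x1 = a * x0 - c"
    by simp
  ultimately have "c / (a - 1) - x1 = a * (c / (a - 1) - x0)"
    by simp
  with assms pos show "log a (c / (a - 1) - x1) = log a (c / (a - 1) - x0) + 1"
    by (simp add: log_mult)
qed

lemma rado_forcing_fixed_point:
  assumes "a > 1" and "c \<ge> a - 1"
  shows "rado_forcing c a (c / (a - 1))"
proof -
  have "c / (a - 1) \<in> {1..c / (a - 1)}" and "c / (a - 1) + c = a * (c / (a - 1))"
    using assms by (simp_all add: field_simps)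
  then show ?thesis
    unfolding rado_forcing_def by blast
qed

theorem theorem2:
  fixes a c :: real
  assumes "a \<ge> 1" and "c > 0" and "c \<ge> a - 1"
  shows "continuous_rado c a = (if a = 1 then \<infinity> else ereal (c / (a - 1)))"
proof (cases "a = 1")
  case True
  with assms show ?thesis
    by (simp add: continuous_rado_def not_rado_forcing_one)
next
  case False
  with assms have "a > 1"
    by simp
  then have forcing: "rado_forcing c a (c / (a - 1))"
    using assms by (simp add: rado_forcing_fixed_point)
  have least: "c / (a - 1) \<le> S" if "rado_forcing c a S" for S
    using not_rado_forcing_below[OF \<open>a > 1\<close>] that not_le by blast
  have "(LEAST R. rado_forcing c a R) = c / (a - 1)"
    using forcing least by (rule Least_equality)
  with forcing least False show ?thesis
    unfolding continuous_rado_def by auto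
qed

end
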